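(* Let $q$ be a nonzero complex number and $n\ge 1$. In the quantum matrix algebra $M_q(2n)$ put, for $1\le i<j\le 2n$, $$b_{ij}=\sum_{m=1}^n\bigl(a_{2m-1,i}a_{2m,j}-q\,a_{2m-1,j}a_{2m,i}\bigr).$$ Then the quantum Pfaffian of $B=(b_{ij})$ equals the quantum determinant of $A=(a_{ij})_{1\le i,j\le 2n}$: $$\mathrm{Pf}_q(B)={\det}_q(A).$$
   Context: $M_q(N)$ is the unital associative complex algebra generated by $a_{ij}$, $1\le i,j\le N$, subject to the relations, for all $i<j$ and $k<l$: $a_{ik}a_{il}=qa_{il}a_{ik}$, $a_{ik}a_{jk}=qa_{jk}a_{ik}$, $a_{jk}a_{il}=a_{il}a_{jk}$, $a_{ik}a_{jl}-a_{jl}a_{ik}=(q-q^{-1})a_{il}a_{jk}$. The quantum determinant is ${\det}_q(A)=\sum_{\sigma\in S_N}(-q)^{l(\sigma)}a_{1,\sigma(1)}\cdots a_{N,\sigma(N)}$, with $l(\sigma)$ the number of inversions of $\sigma$. Quantum Pfaffian: given elements $b_{ij}$ ($1\le i<j\le 2n$) of an associative algebra, define $[s_1,\dots,s_{2p}]$ for $s_1<\cdots<s_{2p}$ in $\{1,\dots,2n\}$ inductively by $[i,j]=b_{ij}$ and $[s_1,\dots,s_{2p}]=\sum_{j=2}^{2p}(-q)^{j-2}[s_1,s_j]\,[s_2,\dots,\widehat{s_j},\dots,s_{2p}]$ for $p\ge2$ (hat means omitted). Then $\mathrm{Pf}_q(B)=[1,2,\dots,2n]$. *)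

theory Defs
  imports
    Complex_Main
    "HOL-Library.Poly_Mapping"
    "HOL-Combinatorics.Permutations"
    "HOL-Algebra.QuotRing"
    "HOL-Algebra.Module"
begin

section \<open>Free associative algebras\<close>

datatype 'a free_word = Word (letters: "'a list")

instantiation free_word :: (type) monoid_add
begin

definition zero_free_word :: "'a free_word"
  where "0 = Word []"

definition plus_free_word :: "'a free_word \<Rightarrow> 'a free_word \<Rightarrow> 'a free_word"
  where "u + v = Word (letters u @ letters v)"

instance
  by standard (simp_all add: zero_free_word_def plus_free_word_def)

end

text \<open>
  A finitely supported function from words to coefficients is a noncommutative polynomial.
  Since \<open>+\<close> on words is concatenation, the multiplication \<open>*\<close> that
  \<^theory>\<open>HOL-Library.Poly_Mapping\<close> provides is the concatenation product.
\<close>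

type_synonym 'x nc_poly = "'x free_word \<Rightarrow>\<^sub>0 complex"

definition nc_var :: "'x \<Rightarrow> 'x nc_poly"
  where "nc_var x = Poly_Mapping.single (Word [x]) 1"

definition nc_const :: "complex \<Rightarrow> 'x nc_poly"
  where "nc_const c = Poly_Mapping.single 0 c"

text \<open>
  Associative complex algebras are represented by the record type \<open>module\<close>, which extends
  \<open>ring\<close> by a scalar multiplication. The locale \<open>algebra\<close> of
  \<^theory>\<open>HOL-Algebra.Module\<close> is not used, as it requires a commutative multiplication.
\<close>

definition free_algebra :: "'x set \<Rightarrow> (complex, 'x nc_poly) module"
  where "free_algebra X =
    \<lparr>carrier = {f. \<forall>w \<in> Poly_Mapping.keys f. set (letters w) \<subseteq> X},
     mult = (*), one = 1, zero = 0, add = (+),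
     smult = (\<lambda>c f. nc_const c * f)\<rparr>"

text \<open>
  The quotient of an algebra by a two-sided ideal. The scalar multiplication follows the pattern
  of \<^const>\<open>rcoset_mult\<close>: all the cosets in the union are equal.
\<close>

definition quot_algebra :: "('c, 'a) module \<Rightarrow> 'a set \<Rightarrow> ('c, 'a set) module"
  where "quot_algebra R I =
    \<lparr>carrier = carrier (R Quot I), mult = mult (R Quot I), one = one (R Quot I),
     zero = zero (R Quot I), add = add (R Quot I),
     smult = (\<lambda>c U. \<Union>u\<in>U. I +>\<^bsub>R\<^esub> (c \<odot>\<^bsub>R\<^esub> u))\<rparr>"


section \<open>The quantum matrix algebra\<close>

text \<open>
  A relation \<open>l = r\<close> is encoded as the element \<open>l - r\<close> of the free algebra. The first family is
  imposed in every row \<open>i\<close> and the second one in every column \<open>k\<close>, including the last row and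
  the last column.
\<close>

definition qmatrix_relations :: "complex \<Rightarrow> nat \<Rightarrow> (nat \<times> nat) nc_poly set"
  where "qmatrix_relations q N =
    (let a = (\<lambda>i j. nc_var (i, j)); c = nc_const in
      {a i k * a i l - c q * (a i l * a i k) | i k l.
        i \<in> {1..N} \<and> k \<in> {1..N} \<and> l \<in> {1..N} \<and> k < l}
    \<union> {a i k * a j k - c q * (a j k * a i k) | i j k.
        i \<in> {1..N} \<and> j \<in> {1..N} \<and> k \<in> {1..N} \<and> i < j}
    \<union> {a j k * a i l - a i l * a j k | i j k l.
        i \<in> {1..N} \<and> j \<in> {1..N} \<and> k \<in> {1..N} \<and> l \<in> {1..N} \<and> i < j \<and> k < l}
    \<union> {a i k * a j l - a j l * a i k - c (q - inverse q) * (a i l * a j k) | i j k l.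
        i \<in> {1..N} \<and> j \<in> {1..N} \<and> k \<in> {1..N} \<and> l \<in> {1..N} \<and> i < j \<and> k < l})"

definition qmatrix_free :: "nat \<Rightarrow> (complex, (nat \<times> nat) nc_poly) module"
  where "qmatrix_free N = free_algebra ({1..N} \<times> {1..N})"

definition qmatrix_ideal :: "complex \<Rightarrow> nat \<Rightarrow> (nat \<times> nat) nc_poly set"
  where "qmatrix_ideal q N = Idl\<^bsub>qmatrix_free N\<^esub> (qmatrix_relations q N)"

definition qmatrix_algebra :: "complex \<Rightarrow> nat \<Rightarrow> (complex, (nat \<times> nat) nc_poly set) module"
  where "qmatrix_algebra q N = quot_algebra (qmatrix_free N) (qmatrix_ideal q N)"

definition qmatrix_gen :: "complex \<Rightarrow> nat \<Rightarrow> nat \<Rightarrow> nat \<Rightarrow> (nat \<times> nat) nc_poly set"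
  where "qmatrix_gen q N i j = qmatrix_ideal q N +>\<^bsub>qmatrix_free N\<^esub> nc_var (i, j)"


section \<open>Quantum determinant and quantum Pfaffian\<close>

definition perm_inversions :: "nat \<Rightarrow> (nat \<Rightarrow> nat) \<Rightarrow> nat"
  where "perm_inversions N \<sigma> =
    card {(i, j). i \<in> {1..N} \<and> j \<in> {1..N} \<and> i < j \<and> \<sigma> i > \<sigma> j}"

definition qdet ::
    "(complex, 'a) module \<Rightarrow> complex \<Rightarrow> nat \<Rightarrow> (nat \<Rightarrow> nat \<Rightarrow> 'a) \<Rightarrow> 'a"
  where "qdet R q N a =
    (\<Oplus>\<^bsub>R\<^esub> \<sigma> \<in> {\<sigma>. \<sigma> permutes {1..N}}.
       (- q) ^ perm_inversions N \<sigma> \<odot>\<^bsub>R\<^esub>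
         foldr (\<lambda>x y. x \<otimes>\<^bsub>R\<^esub> y) (map (\<lambda>i. a i (\<sigma> i)) [1..<Suc N]) \<one>\<^bsub>R\<^esub>)"

text \<open>
  The Pfaffian element \<open>[s\<^sub>1, \<dots>, s\<^sub>2\<^sub>p]\<close> is \<open>qpf_list R q b [s\<^sub>1, \<dots>, s\<^sub>2\<^sub>p]\<close>. In the recursive
  equation the list \<open>t\<close> is \<open>[s\<^sub>2, \<dots>, s\<^sub>2\<^sub>p]\<close> and is indexed from 0, so that position \<open>j\<close> of \<open>t\<close>
  holds the entry with index \<open>j + 2\<close>. The values at the empty list and at lists of odd length
  are junk.
\<close>

fun qpf_list ::
    "(complex, 'a) module \<Rightarrow> complex \<Rightarrow> (nat \<Rightarrow> nat \<Rightarrow> 'a) \<Rightarrow> nat list \<Rightarrow> 'a"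
  where
    "qpf_list R q b [] = \<one>\<^bsub>R\<^esub>"
  | "qpf_list R q b [i, j] = b i j"
  | "qpf_list R q b (s # t) =
      (\<Oplus>\<^bsub>R\<^esub> j \<in> {..<length t}.
         (- q) ^ j \<odot>\<^bsub>R\<^esub> (b s (t ! j) \<otimes>\<^bsub>R\<^esub> qpf_list R q b (take j t @ drop (Suc j) t)))"

definition qpf ::
    "(complex, 'a) module \<Rightarrow> complex \<Rightarrow> nat \<Rightarrow> (nat \<Rightarrow> nat \<Rightarrow> 'a) \<Rightarrow> 'a"
  where "qpf R q n b = qpf_list R q b [1..<Suc (2 * n)]"


section \<open>Well-formedness of the constructions\<close>

lemma keys_free_algebra_mult:
  assumes "f \<in> carrier (free_algebra X)" "g \<in> carrier (free_algebra X)"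
  shows "f * g \<in> carrier (free_algebra X)"
  using assms keys_mult[of f g]
  by (fastforce simp: free_algebra_def plus_free_word_def)

lemma nc_const_carrier: "nc_const c \<in> carrier (free_algebra X)"
  by (auto simp: free_algebra_def nc_const_def zero_free_word_def)

lemma nc_var_carrier: "x \<in> X \<Longrightarrow> nc_var x \<in> carrier (free_algebra X)"
  by (auto simp: free_algebra_def nc_var_def)

lemma ring_free_algebra: "ring (free_algebra X)"
proof (intro ringI abelian_groupI monoidI)
  fix f assume "f \<in> carrier (free_algebra X)"
  then show "\<exists>g\<in>carrier (free_algebra X). g \<oplus>\<^bsub>free_algebra X\<^esub> f = \<zero>\<^bsub>free_algebra X\<^esub>"
    by (intro bexI[of _ "- f"]) (auto simp: free_algebra_def)
next
  fix f g assume "f \<in> carrier (free_algebra X)" "g \<in> carrier (free_algebra X)"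
  then show "f \<oplus>\<^bsub>free_algebra X\<^esub> g \<in> carrier (free_algebra X)"
    using keys_add[of f g] by (fastforce simp: free_algebra_def)
next
  fix f g assume "f \<in> carrier (free_algebra X)" "g \<in> carrier (free_algebra X)"
  then show "f \<otimes>\<^bsub>free_algebra X\<^esub> g \<in> carrier (free_algebra X)"
    using keys_free_algebra_mult by (simp add: free_algebra_def)
next
  show "\<one>\<^bsub>free_algebra X\<^esub> \<in> carrier (free_algebra X)"
    using nc_const_carrier[of 1 X] by (simp add: free_algebra_def nc_const_def)
qed (simp_all add: free_algebra_def algebra_simps)

lemma minus_free_algebra:
  assumes "f \<in> carrier (free_algebra X)" "g \<in> carrier (free_algebra X)"
  shows "f - g \<in> carrier (free_algebra X)"
  using assms keys_diff[of f g] by (fastforce simp: free_algebra_def)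

lemma qmatrix_relations_carrier: "qmatrix_relations q N \<subseteq> carrier (qmatrix_free N)"
  unfolding qmatrix_relations_def qmatrix_free_def Let_def
  by (auto intro!: minus_free_algebra keys_free_algebra_mult nc_const_carrier nc_var_carrier)

lemma ideal_qmatrix_ideal: "ideal (qmatrix_ideal q N) (qmatrix_free N)"
  unfolding qmatrix_ideal_def
  by (intro ring.genideal_ideal qmatrix_relations_carrier)
     (simp add: qmatrix_free_def ring_free_algebra)

lemma ring_qmatrix_algebra: "ring (qmatrix_algebra q N)"
proof -
  define Q where "Q = qmatrix_free N Quot qmatrix_ideal q N"
  interpret Q: ring Q
    unfolding Q_def by (rule ideal.quotient_is_ring[OF ideal_qmatrix_ideal])
  let ?M = "qmatrix_algebra q N"
  have [simp]: "carrier ?M = carrier Q" "mult ?M = mult Q" "one ?M = one Q"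
      "zero ?M = zero Q" "add ?M = add Q"
    by (simp_all only: qmatrix_algebra_def quot_algebra_def Q_def partial_object.simps
        monoid.simps ring.simps)
  show ?thesis
  proof (intro ringI abelian_groupI monoidI)
    fix x assume "x \<in> carrier ?M"
    then show "\<exists>y\<in>carrier ?M. y \<oplus>\<^bsub>?M\<^esub> x = \<zero>\<^bsub>?M\<^esub>"
      using Q.l_neg by (intro bexI[of _ "\<ominus>\<^bsub>Q\<^esub> x"]) simp_all
  qed (simp_all add: Q.a_ac Q.m_assoc Q.l_distr Q.r_distr)
qed

lemma qmatrix_algebra_smult:
  assumes f: "f \<in> carrier (qmatrix_free N)"
  shows "c \<odot>\<^bsub>qmatrix_algebra q N\<^esub> (qmatrix_ideal q N +>\<^bsub>qmatrix_free N\<^esub> f) =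
    qmatrix_ideal q N +>\<^bsub>qmatrix_free N\<^esub> (c \<odot>\<^bsub>qmatrix_free N\<^esub> f)"
proof -
  interpret ideal "qmatrix_ideal q N" "qmatrix_free N"
    by (rule ideal_qmatrix_ideal)
  let ?F = "qmatrix_free N" and ?I = "qmatrix_ideal q N"
  have sm: "c \<odot>\<^bsub>?F\<^esub> g = nc_const c \<otimes>\<^bsub>?F\<^esub> g" for g
    by (simp add: qmatrix_free_def free_algebra_def)
  have c: "nc_const c \<in> carrier ?F"
    by (simp add: qmatrix_free_def nc_const_carrier)
  have "?I +>\<^bsub>?F\<^esub> (c \<odot>\<^bsub>?F\<^esub> g) = ?I +>\<^bsub>?F\<^esub> (c \<odot>\<^bsub>?F\<^esub> f)" if "g \<in> ?I +>\<^bsub>?F\<^esub> f" for g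
  proof -
    from that obtain h where h: "h \<in> ?I" "g = h \<oplus>\<^bsub>?F\<^esub> f"
      by (auto simp: a_r_coset_def')
    have "nc_const c \<otimes>\<^bsub>?F\<^esub> g = nc_const c \<otimes>\<^bsub>?F\<^esub> h \<oplus>\<^bsub>?F\<^esub> nc_const c \<otimes>\<^bsub>?F\<^esub> f"
      using h c f by (simp add: r_distr a_Hcarr)
    moreover have "nc_const c \<otimes>\<^bsub>?F\<^esub> h \<in> ?I"
      using h c by (simp add: I_l_closed)
    ultimately have "nc_const c \<otimes>\<^bsub>?F\<^esub> g \<in> ?I +>\<^bsub>?F\<^esub> (nc_const c \<otimes>\<^bsub>?F\<^esub> f)"
      by (auto simp: a_r_coset_def')
    then show ?thesis
      unfolding sm using c f a_subgroup by (intro a_repr_independence[symmetric]) auto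
  qed
  moreover have "f \<in> ?I +>\<^bsub>?F\<^esub> f"
    using f a_rcos_self by blast
  ultimately have "(\<Union>g\<in>?I +>\<^bsub>?F\<^esub> f. ?I +>\<^bsub>?F\<^esub> (c \<odot>\<^bsub>?F\<^esub> g)) =
      ?I +>\<^bsub>?F\<^esub> (c \<odot>\<^bsub>?F\<^esub> f)"
    by blast
  then show ?thesis
    by (simp only: qmatrix_algebra_def quot_algebra_def module.simps)
qed

end

theory Submission
  imports Defs "HOL-Combinatorics.Multiset_Permutations"
begin

text \<open>
  For rows \<open>R\<close> and columns \<open>C\<close> let \<open>D(R, C)\<close> be the quantum minor. The claim, by induction on \<open>p\<close>,
  is that \<open>[s\<^sub>1, \<dots>, s\<^sub>2\<^sub>p]\<close> is the sum of \<open>D(R, {s\<^sub>1, \<dots>, s\<^sub>2\<^sub>p})\<close> over all unions \<open>R\<close> of \<open>p\<close> of the row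
  pairs \<open>{2m - 1, 2m}\<close>; for \<open>p = n\<close> there is one summand, the determinant. In the recursion the
  entry of \<open>b\<close> with columns \<open>s\<^sub>1 < s\<^sub>j\<close> is rewritten with its \<open>s\<^sub>1\<close> factor on the left. The remaining
  sum over \<open>j\<close> is the row expansion of a minor with the row \<open>2m\<close> or \<open>2m - 1\<close> placed on top: it
  vanishes if that row is repeated, and otherwise sorting the rows costs a power of \<open>-q\<close>. What is
  left is the expansion of \<open>D(R, {s\<^sub>1, \<dots>, s\<^sub>2\<^sub>p})\<close> along its first column. No division occurs, so \<open>q\<close>
  may be a root of unity.
\<close>

section \<open>Inversions and row pairs\<close>

text \<open>The exponent of \<open>-q\<close> in every expansion below. For \<open>x\<close> in
  \<open>A\<close> it counts the neighbours that \<open>x\<close> passes on its way to the front of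
  \<open>A\<close>; for a new element \<open>x\<close> it counts those that \<open>x\<close> passes
  on its way from the front to its place.\<close>

definition rank :: "nat set \<Rightarrow> nat \<Rightarrow> nat"
  where "rank A x = card {y \<in> A. y < x}"

lemma rank_insert:
  assumes "finite A" "s \<notin> A"
  shows "rank (insert s A) x = (if s < x then Suc (rank A x) else rank A x)"
proof -
  have "{y \<in> insert s A. y < x} = (if s < x then insert s {y \<in> A. y < x} else {y \<in> A. y < x})"
    by auto
  then show ?thesis using assms by (simp add: rank_def)
qed

lemma rank_remove:
  assumes "finite A" "s \<in> A"
  shows "rank A x = (if s < x then Suc (rank (A - {s}) x) else rank (A - {s}) x)"
  using rank_insert[of "A - {s}" s x] assms by (simp add: insert_absorb)

lemma rank_eq_0: "(\<And>y. y \<in> A \<Longrightarrow> x \<le> y) \<Longrightarrow> rank A x = 0"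
  unfolding rank_def by (metis (mono_tags, lifting) card.empty empty_Collect_eq leD)

text \<open>Translates the exponent in the Pfaffian recursion, which is a list position, into a
  \<open>rank\<close>, so that the sum over positions becomes a sum over columns.\<close>

lemma rank_nth:
  assumes "sorted_wrt (<) xs" "j < length xs"
  shows "rank (set xs) (xs ! j) = j"
proof -
  have lt: "xs ! i < xs ! j \<longleftrightarrow> i < j" if "i < length xs" for i
    using that assms by (metis linorder_neqE_nat order_less_asym order_less_irrefl sorted_wrt_nth_less)
  have "{y \<in> set xs. y < xs ! j} = (!) xs ` {..<j}"
    using lt assms(2) by (auto simp: in_set_conv_nth) (metis order_less_trans)
  moreover have "inj_on ((!) xs) {..<j}"
    using assms by (metis inj_on_nth lessThan_iff order_less_trans strict_sorted_iff)
  ultimately show ?thesis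
    by (simp add: rank_def card_image)
qed

lemma sorted_wrt_less_remove_nth:
  assumes "sorted_wrt (<) xs" "j < length xs"
  shows "sorted_wrt (<) (take j xs @ drop (Suc j) xs)"
    and "set (take j xs @ drop (Suc j) xs) = set xs - {xs ! j :: nat}"
proof -
  obtain ys x zs where eq: "take j xs = ys" "xs ! j = x" "drop (Suc j) xs = zs" "xs = ys @ x # zs"
    using id_take_nth_drop[OF assms(2)] by blast
  have *: "sorted_wrt (<) (ys @ x # zs)" using assms(1) eq(4) by simp
  show "sorted_wrt (<) (take j xs @ drop (Suc j) xs)"
    unfolding eq(1-3) using * by (auto simp: sorted_wrt_append)
  show "set (take j xs @ drop (Suc j) xs) = set xs - {xs ! j}"
    unfolding eq(1-3) using * by (subst eq(4)) (auto simp: sorted_wrt_append)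
qed

section \<open>Inversions of lists and of permutations\<close>

fun list_inversions :: "nat list \<Rightarrow> nat"
  where
    "list_inversions [] = 0"
  | "list_inversions (x # xs) = rank (set xs) x + list_inversions xs"

lemma list_inversions_map_upt:
  assumes "inj \<sigma>" "k \<le> N"
  shows "list_inversions (map \<sigma> [k..<N]) =
    card {(i, j). k \<le> i \<and> i < j \<and> j < N \<and> \<sigma> j < \<sigma> i}"
  using assms(2)
proof (induction k rule: inc_induct)
  case base
  have "{(i, j). N \<le> i \<and> i < j \<and> j < N \<and> \<sigma> j < \<sigma> i} = {}" by auto
  then show ?case by (simp only: upt_rec[of N N] less_irrefl if_False list.map list_inversions.simps card.empty)
next
  case (step k)
  let ?V = "\<lambda>k. {(i, j). k \<le> i \<and> i < j \<and> j < N \<and> \<sigma> j < \<sigma> i}"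
  let ?J = "{j \<in> {Suc k..<N}. \<sigma> j < \<sigma> k}"
  have fin: "finite (?V k)" for k
    by (rule finite_subset[of _ "{..<N} \<times> {..<N}"]) auto
  have "rank (\<sigma> ` {Suc k..<N}) (\<sigma> k) = card (\<sigma> ` ?J)"
    unfolding rank_def by (rule arg_cong[of _ _ card]) auto
  also have "\<dots> = card ?J"
    by (rule card_image) (use assms(1) in \<open>auto intro: inj_on_subset\<close>)
  also have "\<dots> = card (Pair k ` ?J)"
    by (simp add: card_image inj_on_def)
  finally have r: "rank (\<sigma> ` {Suc k..<N}) (\<sigma> k) = card (Pair k ` ?J)" .
  \<comment> \<open>The inversions are split by whether their first position is \<open>k\<close>;
    those starting at \<open>k\<close> are counted by the \<open>rank\<close> of the head.\<close>
  have "?V k = Pair k ` ?J \<union> ?V (Suc k)"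
    by (auto simp: Suc_le_eq le_less)
  moreover have "Pair k ` ?J \<inter> ?V (Suc k) = {}"
    by auto
  ultimately have "card (?V k) = card (Pair k ` ?J) + card (?V (Suc k))"
    using fin by (simp add: card_Un_disjoint)
  then show ?case
    using step r by (simp add: upt_conv_Cons)
qed

lemma perm_inversions_list_inversions:
  assumes "\<sigma> permutes {1..N}"
  shows "perm_inversions N \<sigma> = list_inversions (map \<sigma> [1..<Suc N])"
  unfolding perm_inversions_def
  by (subst list_inversions_map_upt[OF permutes_inj[OF assms]])
    (auto intro!: arg_cong[of _ _ card])

lemma bij_betw_permutes_permutations_of_set:
  "bij_betw (\<lambda>\<sigma>. map \<sigma> [1..<Suc N]) {\<sigma>. \<sigma> permutes {1..N}} (permutations_of_set {1..N})"
proof -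
  let ?f = "\<lambda>\<sigma>. map \<sigma> [1..<Suc N]"
  have inj: "inj_on ?f {\<sigma>. \<sigma> permutes {1..N}}"
  proof (rule inj_onI, rule ext)
    fix \<sigma> \<tau> :: "nat \<Rightarrow> nat" and x
    assume *: "\<sigma> \<in> {\<sigma>. \<sigma> permutes {1..N}}" "\<tau> \<in> {\<sigma>. \<sigma> permutes {1..N}}" "?f \<sigma> = ?f \<tau>"
    show "\<sigma> x = \<tau> x"
    proof (cases "x \<in> {1..N}")
      case True
      with *(3) show ?thesis by (simp add: map_eq_conv del: upt_Suc)
    next
      case False
      with *(1,2) show ?thesis by (simp add: permutes_not_in)
    qed
  qed
  have "?f ` {\<sigma>. \<sigma> permutes {1..N}} \<subseteq> permutations_of_set {1..N}"
  proof (clarify, rule permutations_of_setI)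
    fix \<sigma> :: "nat \<Rightarrow> nat"
    assume \<sigma>: "\<sigma> permutes {1..N}"
    show "set (?f \<sigma>) = {1..N}"
      using permutes_image[OF \<sigma>] by (simp only: set_map set_upt atLeastLessThanSuc_atLeastAtMost)
    show "distinct (?f \<sigma>)"
      using inj_on_subset[OF permutes_inj[OF \<sigma>]] by (simp add: distinct_map del: upt_Suc)
  qed
  \<comment> \<open>Surjectivity by counting: an injective image inside a finite set of the same
    size is the whole set.\<close>
  moreover have "card (?f ` {\<sigma>. \<sigma> permutes {1..N}}) = card (permutations_of_set {1..N})"
    using card_image[OF inj] card_permutations[of "{1..N}" N] by simp
  ultimately show ?thesis
    unfolding bij_betw_def using inj by (simp add: card_subset_eq)
qed

section \<open>Reindexing of double sums\<close>

lemma sum_distinct_pairs: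
  fixes f :: "nat \<Rightarrow> nat \<Rightarrow> 'b::comm_monoid_add"
  assumes "finite C"
  shows "(\<Sum>c\<in>C. \<Sum>d\<in>C - {c}. f c d) =
    (\<Sum>(c, d)\<in>{(c, d). c \<in> C \<and> d \<in> C \<and> c < d}. f c d + f d c)"
proof -
  let ?U = "{(c, d). c \<in> C \<and> d \<in> C \<and> c < d}"
  let ?L = "{(c, d). c \<in> C \<and> d \<in> C \<and> d < c}"
  have fin: "finite ?U" "finite ?L"
    by (rule finite_subset[of _ "C \<times> C"]; use assms in auto)+
  have "(\<Sum>c\<in>C. \<Sum>d\<in>C - {c}. f c d) = (\<Sum>(c, d)\<in>Sigma C (\<lambda>c. C - {c}). f c d)"
    using assms by (simp add: sum.Sigma)
  also have "Sigma C (\<lambda>c. C - {c}) = ?U \<union> ?L"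
    by auto
  also have "(\<Sum>(c, d)\<in>?U \<union> ?L. f c d) = (\<Sum>(c, d)\<in>?U. f c d) + (\<Sum>(c, d)\<in>?L. f c d)"
    by (rule sum.union_disjoint) (use fin in auto)
  \<comment> \<open>Swapping the coordinates lets both orders of the same two elements be collected
    in one summand.\<close>
  also have "(\<Sum>(c, d)\<in>?L. f c d) = (\<Sum>(c, d)\<in>?U. f d c)"
    by (rule sum.reindex_bij_witness[of _ prod.swap prod.swap]) auto
  finally show ?thesis
    by (simp add: sum.distrib case_prod_unfold)
qed

lemma sum_add_element:
  fixes f :: "'c set \<Rightarrow> 'c \<Rightarrow> 'b::comm_monoid_add"
  assumes "finite S"
  shows "(\<Sum>m\<in>S. \<Sum>T | T \<subseteq> S \<and> card T = p. if m \<in> T then 0 else f (insert m T) m) =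
    (\<Sum>T | T \<subseteq> S \<and> card T = Suc p. \<Sum>m\<in>T. f T m)"
proof -
  have fin: "finite {T. T \<subseteq> S \<and> card T = k}" for k
    using assms by simp
  have fin': "finite T" if "T \<subseteq> S" for T
    using that assms finite_subset by blast
  have "(\<Sum>m\<in>S. \<Sum>T | T \<subseteq> S \<and> card T = p. if m \<in> T then 0 else f (insert m T) m) =
    (\<Sum>m\<in>S. \<Sum>T\<in>{T \<in> {T. T \<subseteq> S \<and> card T = p}. m \<notin> T}. f (insert m T) m)"
    by (intro sum.cong refl sum.mono_neutral_cong_right fin) auto
  also have "\<dots> = (\<Sum>(m, T)\<in>Sigma S (\<lambda>m. {T \<in> {T. T \<subseteq> S \<and> card T = p}. m \<notin> T}). f (insert m T) m)"
    using assms by (intro sum.Sigma) auto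
  \<comment> \<open>Double counting: a \<open>p\<close>-subset with a new element \<open>m\<close>
    corresponds to a subset of size \<open>Suc p\<close> with a marked element
    \<open>m\<close>.\<close>
  also have "\<dots> = (\<Sum>(T, m)\<in>Sigma {T. T \<subseteq> S \<and> card T = Suc p} (\<lambda>T. T). f T m)"
    by (rule sum.reindex_bij_witness[of _ "\<lambda>(T, m). (m, T - {m})" "\<lambda>(m, T). (insert m T, m)"])
      (use fin' in \<open>auto simp: insert_absorb\<close>)
  also have "\<dots> = (\<Sum>T | T \<subseteq> S \<and> card T = Suc p. \<Sum>m\<in>T. f T m)"
    using fin fin' by (intro sum.Sigma[symmetric]) auto
  finally show ?thesis .
qed

section \<open>Unions of row pairs\<close>

definition row_pairs :: "nat set \<Rightarrow> nat set"
  where "row_pairs T = (\<Union>m\<in>T. {2 * m - 1, 2 * m})"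

lemma row_pairs_disjoint:
  "\<lbrakk>m \<noteq> l; m \<ge> 1; l \<ge> 1\<rbrakk> \<Longrightarrow> {2 * m - 1, 2 * m} \<inter> {2 * l - 1, 2 * l :: nat} = {}"
  by auto

lemma row_pairs_subset: "T \<subseteq> {1..n} \<Longrightarrow> row_pairs T \<subseteq> {1..2 * n}"
  by (fastforce simp: row_pairs_def)

lemma row_pairs_subset_rows: "\<lbrakk>T \<subseteq> {1..n}; 2 * n \<le> N\<rbrakk> \<Longrightarrow> row_pairs T \<subseteq> {1..N}"
  using row_pairs_subset[of T n] by force

lemma mem_row_pairs:
  assumes "T \<subseteq> {1..n}" "m \<ge> 1"
  shows "2 * m \<in> row_pairs T \<longleftrightarrow> m \<in> T" "2 * m - 1 \<in> row_pairs T \<longleftrightarrow> m \<in> T"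
proof -
  have "2 * m \<in> {2 * l - 1, 2 * l} \<longleftrightarrow> l = m" "2 * m - 1 \<in> {2 * l - 1, 2 * l} \<longleftrightarrow> l = m"
    if "l \<in> T" for l
  proof -
    have "l \<ge> 1" using that assms(1) by auto
    with assms(2) show "2 * m \<in> {2 * l - 1, 2 * l} \<longleftrightarrow> l = m"
        "2 * m - 1 \<in> {2 * l - 1, 2 * l} \<longleftrightarrow> l = m"
      unfolding insert_iff empty_iff by presburger+
  qed
  then show "2 * m \<in> row_pairs T \<longleftrightarrow> m \<in> T" "2 * m - 1 \<in> row_pairs T \<longleftrightarrow> m \<in> T"
    unfolding row_pairs_def by blast+
qed

lemma sum_row_pairs:
  assumes "T \<subseteq> {1..n}"
  shows "sum f (row_pairs T) = (\<Sum>m\<in>T. \<Sum>r\<in>{2 * m - 1, 2 * m}. f r)"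
  unfolding row_pairs_def
  by (rule sum.UNION_disjoint)
    (use assms finite_subset[OF assms] row_pairs_disjoint in \<open>auto simp: subset_iff\<close>)

lemma card_row_pairs:
  assumes "T \<subseteq> {1..n}"
  shows "card (row_pairs T) = 2 * card T"
proof -
  have "(\<Sum>r\<in>{2 * m - 1, 2 * m}. 1) = (2 :: nat)" if "m \<in> T" for m
    using subsetD[OF assms that] by (subst sum.insert) auto
  then show ?thesis
    using sum_row_pairs[OF assms, of "\<lambda>_. 1 :: nat"] by simp
qed

text \<open>The second and third equations of \<open>qpf_list\<close> overlap on lists of length
  two, where the second one is taken. Away from them the recursion holds as written.\<close>

lemma qpf_list_Cons:
  "length t \<noteq> 1 \<Longrightarrow> qpf_list R q b (s # t) =
    (\<Oplus>\<^bsub>R\<^esub> j \<in> {..<length t}.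
       (- q) ^ j \<odot>\<^bsub>R\<^esub> (b s (t ! j) \<otimes>\<^bsub>R\<^esub> qpf_list R q b (take j t @ drop (Suc j) t)))"
  by (cases "(R, q, b, s # t)" rule: qpf_list.cases) auto

section \<open>Quantum minors\<close>

text \<open>The parameter \<open>z\<close> stands for \<open>-q\<close>.\<close>

locale central_minor =
  fixes z :: "'r::ring_1" and a :: "nat \<Rightarrow> nat \<Rightarrow> 'r"
  assumes z_central: "x * z = z * x"
begin

lemma zpow_central: "x * z ^ k = z ^ k * x"
  by (metis power_commuting_commutes z_central)

lemma zpow_left_commute: "x * (z ^ k * y) = z ^ k * (x * y)"
  by (metis mult.assoc zpow_central)

lemma gen_zpow: "a i j * (z ^ k * y) = z ^ k * (a i j * y)"
  by (rule zpow_left_commute)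

text \<open>Defined by expansion along the top row. Rows form a list so that they may be out of
  order or repeated while a row is being moved; for increasing rows and equally many columns this is
  the usual quantum minor.\<close>

fun minor :: "nat list \<Rightarrow> nat set \<Rightarrow> 'r"
  where
    "minor [] C = 1"
  | "minor (r # R) C = (\<Sum>c\<in>C. z ^ rank C c * (a r c * minor R (C - {c})))"

text \<open>Choosing columns \<open>c < d\<close> for the first two rows in either order leaves the
  same remaining minor, so the two terms combine into a 2 by 2 minor. This isolates the only place
  where a relation between two adjacent rows has to be applied.\<close>

lemma minor_two_rows:
  assumes "finite C"
  shows "minor (r # s # R) C =
    (\<Sum>(c, d)\<in>{(c, d). c \<in> C \<and> d \<in> C \<and> c < d}.
       z ^ (rank C c + rank (C - {c}) d) *
         ((a r c * a s d + z * (a r d * a s c)) * minor R (C - {c} - {d})))"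
proof -
  have "minor (r # s # R) C = (\<Sum>c\<in>C. \<Sum>d\<in>C - {c}.
      z ^ (rank C c + rank (C - {c}) d) * (a r c * a s d * minor R (C - {c} - {d})))"
    by (simp add: sum_distrib_left gen_zpow power_add mult.assoc)
  also have "\<dots> = (\<Sum>(c, d)\<in>{(c, d). c \<in> C \<and> d \<in> C \<and> c < d}.
      z ^ (rank C c + rank (C - {c}) d) * (a r c * a s d * minor R (C - {c} - {d})) +
      z ^ (rank C d + rank (C - {d}) c) * (a r d * a s c * minor R (C - {d} - {c})))"
    by (rule sum_distinct_pairs[OF assms])
  also have "\<dots> = (\<Sum>(c, d)\<in>{(c, d). c \<in> C \<and> d \<in> C \<and> c < d}.
       z ^ (rank C c + rank (C - {c}) d) *
         ((a r c * a s d + z * (a r d * a s c)) * minor R (C - {c} - {d})))"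
  proof (rule sum.cong[OF refl], clarify)
    fix c d assume cd: "c \<in> C" "d \<in> C" "c < d"
    \<comment> \<open>Removing the smaller column lowers the rank of \<open>d\<close>, whereas
      removing the larger one does not affect \<open>c\<close>; hence the swapped term carries one
      more factor \<open>z\<close>.\<close>
    have 1: "rank C d = Suc (rank (C - {c}) d)" "rank C c = rank (C - {d}) c"
      using rank_remove[OF assms cd(1), of d] rank_remove[OF assms cd(2), of c] cd by auto
    have 2: "C - {d} - {c} = C - {c} - {d}" by auto
    show "z ^ (rank C c + rank (C - {c}) d) * (a r c * a s d * minor R (C - {c} - {d})) +
      z ^ (rank C d + rank (C - {d}) c) * (a r d * a s c * minor R (C - {d} - {c})) =
      z ^ (rank C c + rank (C - {c}) d) *
         ((a r c * a s d + z * (a r d * a s c)) * minor R (C - {c} - {d}))"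
      unfolding 1(1) 1(2)[symmetric] 2
      by (simp add: distrib_left distrib_right mult.assoc power_Suc2 add.commute[of _ "rank C c"]
          del: power_Suc)
  qed
  finally show ?thesis .
qed

text \<open>Sort the column lists by their head \<open>c\<close>: it is the column chosen in the top
  row, and it is inverted with exactly \<open>rank C c\<close> later entries. The powers of
  \<open>z\<close> are central and can be collected on the left.\<close>

lemma minor_Leibniz:
  assumes "finite C" "length R = card C"
  shows "minor R C = (\<Sum>xs\<in>permutations_of_set C.
    z ^ list_inversions xs * foldr (*) (map2 a R xs) 1)"
  using assms
proof (induction R arbitrary: C)
  case Nil
  then show ?case by simp
next
  case (Cons r R)
  have ne: "C \<noteq> {}" using Cons.prems by auto
  have rk: "rank (C - {c}) c = rank C c" if "c \<in> C" for c
    using rank_remove[OF Cons.prems(1) that, of c] by simp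
  have "(\<Sum>xs\<in>permutations_of_set C. z ^ list_inversions xs * foldr (*) (map2 a (r # R) xs) 1) =
    (\<Sum>c\<in>C. \<Sum>xs\<in>(#) c ` permutations_of_set (C - {c}).
       z ^ list_inversions xs * foldr (*) (map2 a (r # R) xs) 1)"
    unfolding permutations_of_set_nonempty[OF ne]
    by (rule sum.UNION_disjoint) (use Cons.prems in auto)
  also have "\<dots> = (\<Sum>c\<in>C. \<Sum>xs\<in>permutations_of_set (C - {c}).
       z ^ rank C c * (a r c * (z ^ list_inversions xs * foldr (*) (map2 a R xs) 1)))"
  proof (rule sum.cong[OF refl])
    fix c assume c: "c \<in> C"
    have "(\<Sum>xs\<in>(#) c ` permutations_of_set (C - {c}).
        z ^ list_inversions xs * foldr (*) (map2 a (r # R) xs) 1) =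
      (\<Sum>xs\<in>permutations_of_set (C - {c}). z ^ list_inversions (c # xs) *
        foldr (*) (map2 a (r # R) (c # xs)) 1)"
      by (subst sum.reindex) (simp_all add: inj_on_def)
    also have "\<dots> = (\<Sum>xs\<in>permutations_of_set (C - {c}).
       z ^ rank C c * (a r c * (z ^ list_inversions xs * foldr (*) (map2 a R xs) 1)))"
    proof (rule sum.cong[OF refl])
      fix xs assume "xs \<in> permutations_of_set (C - {c})"
      then have "rank (set xs) c = rank C c"
        using rk[OF c] permutations_of_setD(1) by metis
      then show "z ^ list_inversions (c # xs) * foldr (*) (map2 a (r # R) (c # xs)) 1 =
          z ^ rank C c * (a r c * (z ^ list_inversions xs * foldr (*) (map2 a R xs) 1))"
        by (simp add: power_add gen_zpow mult.assoc)
    qed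
    finally show "(\<Sum>xs\<in>(#) c ` permutations_of_set (C - {c}).
        z ^ list_inversions xs * foldr (*) (map2 a (r # R) xs) 1) = \<dots>" .
  qed
  also have "\<dots> = (\<Sum>c\<in>C. z ^ rank C c * (a r c * minor R (C - {c})))"
    by (intro sum.cong refl) (use Cons in \<open>simp flip: sum_distrib_left\<close>)
  finally show ?case by simp
qed

text \<open>For \<open>z = -q\<close> a representative of the entry \<open>b_ij\<close> in the
  ambient ring, before passing to the quotient.\<close>

definition pair_form :: "nat \<Rightarrow> nat \<Rightarrow> nat \<Rightarrow> 'r"
  where "pair_form n i j =
    (\<Sum>m=1..n. a (2 * m - 1) i * a (2 * m) j + z * (a (2 * m - 1) j * a (2 * m) i))"

text \<open>The closed form of the Pfaffian element with column set \<open>C\<close> of size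
  \<open>2 * p\<close>; \<open>T\<close> records which row pairs are used.\<close>

definition pair_minor_sum :: "nat \<Rightarrow> nat \<Rightarrow> nat set \<Rightarrow> 'r"
  where "pair_minor_sum n p C =
    (\<Sum>T | T \<subseteq> {1..n} \<and> card T = p. minor (sorted_list_of_set (row_pairs T)) C)"

lemma pair_minor_sum_0: "pair_minor_sum n 0 C = 1"
proof -
  have "{T. T \<subseteq> {1..n} \<and> card T = 0} = {{}}"
    using finite_subset by fastforce
  then show ?thesis
    by (simp add: pair_minor_sum_def row_pairs_def)
qed

lemma pair_minor_sum_full: "pair_minor_sum n n C = minor [1..<Suc (2 * n)] C"
proof -
  have "{T. T \<subseteq> {1..n} \<and> card T = n} = {{1..n}}"
    using card_subset_eq[of "{1..n}"] by auto
  moreover have "row_pairs {1..n} = {1..2 * n}"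
    using card_row_pairs[of "{1..n}" n] row_pairs_subset[of "{1..n}" n]
    by (intro card_subset_eq) auto
  moreover have "sorted_list_of_set {1..2 * n} = [1..<Suc (2 * n)]"
    by (metis atLeastLessThanSuc_atLeastAtMost sorted_list_of_set_range)
  ultimately show ?thesis
    by (simp add: pair_minor_sum_def del: upt_Suc)
qed

end

section \<open>The quantum matrix relations\<close>

text \<open>
  The relations are imposed only modulo \<open>I\<close>, which is an ideal of the subring \<open>A\<close>: this allows
  computing with type class sums in the ambient free algebra. The last assumption combines two of
  the defining relations and states that \<open>2 \<times> 2\<close> minors are \<open>q\<close>-alternating in their rows.
\<close>

locale quantum_matrix_modulo = central_minor z a
  for z :: "'r::ring_1" and a :: "nat \<Rightarrow> nat \<Rightarrow> 'r" +
  fixes N :: nat and A I :: "'r set"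
  assumes A_one: "1 \<in> A"
    and A_add: "\<lbrakk>x \<in> A; y \<in> A\<rbrakk> \<Longrightarrow> x + y \<in> A"
    and A_mult: "\<lbrakk>x \<in> A; y \<in> A\<rbrakk> \<Longrightarrow> x * y \<in> A"
    and A_zero: "0 \<in> A"
    and A_z: "z \<in> A"
    and A_gen: "\<lbrakk>i \<in> {1..N}; j \<in> {1..N}\<rbrakk> \<Longrightarrow> a i j \<in> A"
    and I_zero: "0 \<in> I"
    and I_diff: "\<lbrakk>x \<in> I; y \<in> I\<rbrakk> \<Longrightarrow> x - y \<in> I"
    and I_left: "\<lbrakk>x \<in> A; y \<in> I\<rbrakk> \<Longrightarrow> x * y \<in> I"
    and I_right: "\<lbrakk>x \<in> I; y \<in> A\<rbrakk> \<Longrightarrow> x * y \<in> I"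
    and row_rel: "\<lbrakk>i \<in> {1..N}; k \<in> {1..N}; l \<in> {1..N}; k < l\<rbrakk>
      \<Longrightarrow> a i k * a i l + z * (a i l * a i k) \<in> I"
    and cross_rel: "\<lbrakk>i \<in> {1..N}; j \<in> {1..N}; k \<in> {1..N}; l \<in> {1..N}; i < j; k < l\<rbrakk>
      \<Longrightarrow> a j k * a i l - a i l * a j k \<in> I"
    and swap_rel: "\<lbrakk>i \<in> {1..N}; j \<in> {1..N}; k \<in> {1..N}; l \<in> {1..N}; i < j; k < l\<rbrakk>
      \<Longrightarrow> a j k * a i l + z * (a j l * a i k) - z * (a i k * a j l + z * (a i l * a j k)) \<in> I"
begin

section \<open>Congruence modulo the ideal\<close>

definition congr :: "'r \<Rightarrow> 'r \<Rightarrow> bool"  (infix "\<approx>" 50)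
  where "x \<approx> y \<longleftrightarrow> x - y \<in> I"

lemma I_add: "\<lbrakk>x \<in> I; y \<in> I\<rbrakk> \<Longrightarrow> x + y \<in> I"
  using I_diff[of x "0 - y"] I_diff[of 0 y] I_zero by simp

lemma congr_refl [simp]: "x \<approx> x"
  by (simp add: congr_def I_zero)

lemma congr_sym: "x \<approx> y \<Longrightarrow> y \<approx> x"
  using I_diff[OF I_zero, of "x - y"] by (simp add: congr_def)

lemma congr_trans [trans]: "\<lbrakk>x \<approx> y; y \<approx> w\<rbrakk> \<Longrightarrow> x \<approx> w"
  using I_add[of "x - y" "y - w"] by (simp add: congr_def)

lemma congr_add: "\<lbrakk>x \<approx> x'; y \<approx> y'\<rbrakk> \<Longrightarrow> x + y \<approx> x' + y'"
  using I_add[of "x - x'" "y - y'"] by (simp add: congr_def algebra_simps)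

text \<open>Since \<open>I\<close> is assumed to absorb only factors from \<open>A\<close>,
  multiplying a congruence requires membership of the factor in \<open>A\<close>. The lemmas
  \<open>A_sum\<close>, \<open>A_zpow\<close>, \<open>A_minor\<close>, \<open>A_pair_form\<close>
  and \<open>A_pair_minor_sum\<close> supply these side conditions.\<close>

lemma congr_left: "\<lbrakk>w \<in> A; x \<approx> y\<rbrakk> \<Longrightarrow> w * x \<approx> w * y"
  using I_left[of w "x - y"] by (simp add: congr_def algebra_simps)

lemma congr_right: "\<lbrakk>w \<in> A; x \<approx> y\<rbrakk> \<Longrightarrow> x * w \<approx> y * w"
  using I_right[of "x - y" w] by (simp add: congr_def algebra_simps)

lemma congr_sum: "(\<And>i. i \<in> S \<Longrightarrow> f i \<approx> g i) \<Longrightarrow> sum f S \<approx> sum g S"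
  by (induction S rule: infinite_finite_induct) (auto intro: congr_add)

lemma A_sum: "(\<And>i. i \<in> S \<Longrightarrow> f i \<in> A) \<Longrightarrow> sum f S \<in> A"
  by (induction S rule: infinite_finite_induct) (auto intro: A_add A_zero)

lemma A_zpow: "z ^ k \<in> A"
  by (induction k) (auto intro: A_mult A_one A_z)

lemma A_minor: "\<lbrakk>set R \<subseteq> {1..N}; C \<subseteq> {1..N}\<rbrakk> \<Longrightarrow> minor R C \<in> A"
proof (induction R arbitrary: C)
  case (Cons r R)
  then have "minor R (C - {c}) \<in> A" for c by (metis Diff_subset set_subset_Cons subset_trans)
  with Cons.prems show ?case
    by (auto intro!: A_sum A_mult A_zpow A_gen)
qed (simp add: A_one)

section \<open>Moving a row within a minor\<close>

lemma minor_swap: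
  assumes "r < s" "set (r # s # R) \<subseteq> {1..N}" "C \<subseteq> {1..N}"
  shows "minor (s # r # R) C \<approx> z * minor (r # s # R) C"
proof -
  have fin: "finite C" using assms finite_subset by blast
  have "minor (s # r # R) C \<approx> (\<Sum>(c, d)\<in>{(c, d). c \<in> C \<and> d \<in> C \<and> c < d}.
       z ^ (rank C c + rank (C - {c}) d) *
         (z * (a r c * a s d + z * (a r d * a s c)) * minor R (C - {c} - {d})))"
    unfolding minor_two_rows[OF fin]
  proof (rule congr_sum, clarify)
    fix c d assume cd: "c \<in> C" "d \<in> C" "c < d"
    \<comment> \<open>After expansion along two rows only their 2 by 2 minors change, and for these
      the exchange is \<open>swap_rel\<close>.\<close>
    then have "a s c * a r d + z * (a s d * a r c) \<approx> z * (a r c * a s d + z * (a r d * a s c))"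
      unfolding congr_def using assms by (intro swap_rel) auto
    moreover have "minor R (C - {c} - {d}) \<in> A"
      using assms by (intro A_minor) auto
    ultimately show "z ^ (rank C c + rank (C - {c}) d) *
         ((a s c * a r d + z * (a s d * a r c)) * minor R (C - {c} - {d})) \<approx>
       z ^ (rank C c + rank (C - {c}) d) *
         (z * (a r c * a s d + z * (a r d * a s c)) * minor R (C - {c} - {d}))"
      by (intro congr_left congr_right A_zpow)
  qed
  also have "\<dots> = z * minor (r # s # R) C"
    unfolding minor_two_rows[OF fin] sum_distrib_left
    by (intro sum.cong refl) (auto simp: mult.assoc power_commutes zpow_left_commute[of z])
  finally show ?thesis .
qed

text \<open>The 2 by 2 minors of a row with itself are the elements of \<open>row_rel\<close>.
  Vanishing thus comes directly from a relation and not from an exchange argument, which would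
  require a division.\<close>

lemma minor_repeated_row:
  assumes "set (r # R) \<subseteq> {1..N}" "C \<subseteq> {1..N}"
  shows "minor (r # r # R) C \<approx> 0"
proof -
  have fin: "finite C" using assms finite_subset by blast
  have "minor (r # r # R) C \<approx> (\<Sum>(c, d)\<in>{(c, d). c \<in> C \<and> d \<in> C \<and> c < d}.
       z ^ (rank C c + rank (C - {c}) d) * (0 * minor R (C - {c} - {d})))"
    unfolding minor_two_rows[OF fin]
  proof (rule congr_sum, clarify)
    fix c d assume cd: "c \<in> C" "d \<in> C" "c < d"
    then have "a r c * a r d + z * (a r d * a r c) \<approx> 0"
      unfolding congr_def diff_zero using assms by (intro row_rel) auto
    moreover have "minor R (C - {c} - {d}) \<in> A"
      using assms by (intro A_minor) auto
    ultimately show "z ^ (rank C c + rank (C - {c}) d) *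
         ((a r c * a r d + z * (a r d * a r c)) * minor R (C - {c} - {d})) \<approx>
       z ^ (rank C c + rank (C - {c}) d) * (0 * minor R (C - {c} - {d}))"
      by (intro congr_left congr_right A_zpow)
  qed
  then show ?thesis by simp
qed

text \<open>Lets rows be moved below a fixed top row. Centrality of \<open>w\<close> is what carries
  it past the entry of that row; it will be \<open>0\<close> or a power of \<open>z\<close>.\<close>

lemma minor_Cons_congr:
  assumes "r \<in> {1..N}" "C \<subseteq> {1..N}" and w: "\<And>x. x * w = w * x"
    and R: "\<And>c. c \<in> C \<Longrightarrow> minor R (C - {c}) \<approx> w * minor R' (C - {c})"
  shows "minor (r # R) C \<approx> w * minor (r # R') C"
proof -
  have "minor (r # R) C \<approx> (\<Sum>c\<in>C. z ^ rank C c * (a r c * (w * minor R' (C - {c}))))"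
    unfolding minor.simps using assms by (intro congr_sum congr_left A_zpow A_gen R) auto
  also have "\<dots> = w * minor (r # R') C"
    unfolding minor.simps sum_distrib_left by (intro sum.cong refl) (metis mult.assoc w)
  finally show ?thesis .
qed

text \<open>The row \<open>r\<close> sinks by exchanges with smaller rows, each costing a factor
  \<open>z\<close>, and meeting an equal row gives zero. In that case \<open>insort\<close>
  duplicates \<open>r\<close>, but the coefficient is \<open>0\<close>. Writing both cases as one
  central coefficient fits \<open>minor_Cons_congr\<close>.\<close>

lemma minor_insort_row:
  assumes "sorted_wrt (<) R" "set (r # R) \<subseteq> {1..N}" "C \<subseteq> {1..N}"
  shows "minor (r # R) C \<approx>
    (if r \<in> set R then 0 else z ^ rank (set R) r) * minor (insort r R) C"
  using assms
proof (induction R arbitrary: C)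
  case Nil
  then show ?case by (simp add: rank_def)
next
  case (Cons x R)
  consider "r < x" | "r = x" | "x < r" by linarith
  then show ?case
  proof cases
    case 1
    then have "r \<notin> set (x # R)" "rank (set (x # R)) r = 0"
      using Cons.prems by (fastforce intro: rank_eq_0)+
    with 1 show ?thesis by simp
  next
    case 2
    then show ?thesis using minor_repeated_row[of r R C] Cons.prems by simp
  next
    case 3
    let ?w = "if r \<in> set R then 0 else z ^ rank (set R) r"
    have xR: "x \<notin> set R" using Cons.prems by auto
    have w: "y * ?w = ?w * y" for y using zpow_central by simp
    have "minor (r # x # R) C \<approx> z * minor (x # r # R) C"
      using Cons.prems 3 by (intro minor_swap) auto
    \<comment> \<open>The induction hypothesis acts below the row \<open>x\<close>, on every column
      set with one column removed.\<close>
    also have "z * minor (x # r # R) C \<approx> z * (?w * minor (x # insort r R) C)"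
      using Cons.prems by (intro congr_left A_z minor_Cons_congr w Cons.IH) auto
    also have "\<dots> = (if r \<in> set (x # R) then 0 else z ^ rank (set (x # R)) r) *
        minor (insort r (x # R)) C"
      using 3 xR by (simp add: rank_insert mult.assoc)
    finally show ?thesis .
  qed
qed

text \<open>Expand along the top row \<open>x\<close>. The column \<open>s\<close> gives the summand
  for \<open>r = x\<close>. For any other column the rest is expanded along \<open>s\<close> by
  induction, the entry from column \<open>s\<close> is moved to the left, and the sum over
  \<open>c\<close> closes up again to a minor with top row \<open>x\<close>.\<close>

lemma minor_first_column:
  assumes "sorted_wrt (<) R" "set R \<subseteq> {1..N}" "insert s C \<subseteq> {1..N}"
    and "\<And>c. c \<in> C \<Longrightarrow> s < c" "length R = Suc (card C)"
  shows "minor R (insert s C) \<approx>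
    (\<Sum>r\<in>set R. z ^ rank (set R) r * (a r s * minor (remove1 r R) C))"
  using assms
proof (induction R arbitrary: C)
  case Nil
  then show ?case by simp
next
  case (Cons x R)
  have fin: "finite C"
    using finite_subset[OF Cons.prems(3)] by simp
  have s: "s \<notin> C" using Cons.prems by auto
  have xR: "x \<notin> set R" and lt: "\<And>r. r \<in> set R \<Longrightarrow> x < r" using Cons.prems by auto
  let ?g = "\<lambda>r c. z ^ rank (set R) r * (a r s * minor (remove1 r R) (C - {c}))"
  have "minor (x # R) (insert s C) = a x s * minor R C +
      (\<Sum>c\<in>C. z ^ Suc (rank C c) * (a x c * minor R (insert s (C - {c}))))"
  proof -
    have "rank (insert s C) s = 0" 
      using Cons.prems(4) by (intro rank_eq_0) (auto simp: less_imp_le)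
    moreover have "insert s C - {s} = C" using s by auto
    moreover have "(\<Sum>c\<in>C. z ^ rank (insert s C) c * (a x c * minor R (insert s C - {c}))) =
      (\<Sum>c\<in>C. z ^ Suc (rank C c) * (a x c * minor R (insert s (C - {c}))))"
      using s Cons.prems fin by (intro sum.cong refl) (auto simp: rank_insert insert_Diff_if)
    ultimately show ?thesis using fin s by simp
  qed
  also have "\<dots> \<approx> a x s * minor R C +
      (\<Sum>c\<in>C. z ^ Suc (rank C c) * (\<Sum>r\<in>set R. z ^ rank (set R) r *
        (a r s * (a x c * minor (remove1 r R) (C - {c})))))"
  proof (intro congr_add congr_refl congr_sum congr_left A_zpow)
    fix c assume c: "c \<in> C"
    have "a x c * minor R (insert s (C - {c})) \<approx> a x c * (\<Sum>r\<in>set R. ?g r c)"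
    proof (intro congr_left A_gen Cons.IH)
      show "length R = Suc (card (C - {c}))"
        using Cons.prems(5) card.remove[OF fin c] by (metis length_Cons nat.inject)
    qed (use Cons.prems(1-4) c in auto)
    also have "\<dots> = (\<Sum>r\<in>set R. z ^ rank (set R) r * (a x c * a r s * minor (remove1 r R) (C - {c})))"
      by (simp add: sum_distrib_left gen_zpow mult.assoc)
    also have "\<dots> \<approx> (\<Sum>r\<in>set R. z ^ rank (set R) r *
        (a r s * a x c * minor (remove1 r R) (C - {c})))"
    proof (intro congr_sum congr_left A_zpow congr_right)
      fix r assume r: "r \<in> set R"
      show "minor (remove1 r R) (C - {c}) \<in> A"
        using Cons.prems set_remove1_subset[of r R] by (intro A_minor) auto
      \<comment> \<open>Row \<open>r\<close> is below \<open>x\<close> and column \<open>s\<close>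
        is left of \<open>c\<close>, so these two entries lie on an antidiagonal and commute modulo
        \<open>I\<close>.\<close>
      have "a r s * a x c \<approx> a x c * a r s"
        unfolding congr_def using Cons.prems c r lt by (intro cross_rel) auto
      then show "a x c * a r s \<approx> a r s * a x c" by (rule congr_sym)
    qed
    finally show "a x c * minor R (insert s (C - {c})) \<approx> (\<Sum>r\<in>set R. z ^ rank (set R) r *
        (a r s * (a x c * minor (remove1 r R) (C - {c}))))"
      by (simp add: mult.assoc)
  qed
  also have "(\<Sum>c\<in>C. z ^ Suc (rank C c) * (\<Sum>r\<in>set R. z ^ rank (set R) r *
        (a r s * (a x c * minor (remove1 r R) (C - {c}))))) =
      (\<Sum>r\<in>set R. z ^ Suc (rank (set R) r) * (a r s * minor (x # remove1 r R) C))"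
  proof -
    \<comment> \<open>The extra factor \<open>z\<close> arose because \<open>s\<close> precedes
      \<open>c\<close>; it is now credited to \<open>x\<close> preceding \<open>r\<close>.\<close>
    have "z ^ Suc j * (z ^ k * y) = z ^ Suc k * (z ^ j * y)" for j k y
      by (simp add: add.commute flip: mult.assoc power_add power_Suc)
    then show ?thesis
      unfolding sum_distrib_left minor.simps
      by (subst sum.swap) (intro sum.cong refl, simp only: gen_zpow)
  qed
  also have "a x s * minor R C + \<dots> =
      (\<Sum>r\<in>set (x # R). z ^ rank (set (x # R)) r * (a r s * minor (remove1 r (x # R)) C))"
  proof -
    have "rank (set (x # R)) x = 0" using lt by (intro rank_eq_0) (auto simp: less_imp_le)
    moreover have "(\<Sum>r\<in>set R. z ^ rank (set (x # R)) r * (a r s * minor (remove1 r (x # R)) C)) =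
      (\<Sum>r\<in>set R. z ^ Suc (rank (set R) r) * (a r s * minor (x # remove1 r R) C))"
      using lt xR by (intro sum.cong refl) (auto simp: rank_insert)
    ultimately show ?thesis using xR by simp
  qed
  finally show ?case .
qed

lemma minor_insert_row:
  assumes "R \<subseteq> {1..N}" "r \<in> {1..N}" "C \<subseteq> {1..N}"
  shows "minor (r # sorted_list_of_set R) C \<approx>
    (if r \<in> R then 0 else z ^ rank R r * minor (sorted_list_of_set (insert r R)) C)"
proof -
  have "finite R" using finite_subset[OF assms(1)] by simp
  then show ?thesis
    using minor_insort_row[of "sorted_list_of_set R" r C] assms
    by (auto simp: sorted_list_of_set_insert insert_absorb)
qed

lemma minor_expand_first_column:
  assumes "R \<subseteq> {1..N}" "insert s C \<subseteq> {1..N}"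
    and "\<And>c. c \<in> C \<Longrightarrow> s < c" "card R = Suc (card C)"
  shows "minor (sorted_list_of_set R) (insert s C) \<approx>
    (\<Sum>r\<in>R. z ^ rank R r * (a r s * minor (sorted_list_of_set (R - {r})) C))"
proof -
  have "finite R" using finite_subset[OF assms(1)] by simp
  then show ?thesis
    using minor_first_column[of "sorted_list_of_set R" s C] assms
    by (simp add: sorted_list_of_set_remove)
qed

section \<open>The recursion for sums of minors over row pairs\<close>

lemma pair_form_expand:
  assumes "2 * n \<le> N" "i \<in> {1..N}" "j \<in> {1..N}" "i < j"
  shows "pair_form n i j \<approx>
    (\<Sum>m=1..n. a (2 * m - 1) i * a (2 * m) j + z * (a (2 * m) i * a (2 * m - 1) j))"
  unfolding pair_form_def
proof (intro congr_sum congr_add congr_refl congr_left A_z)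
  fix m assume "m \<in> {1..n}"
  \<comment> \<open>Only the second product has its factor from column \<open>i\<close> on the
    right; its two entries lie on an antidiagonal and may be exchanged.\<close>
  then have "a (2 * m) i * a (2 * m - 1) j \<approx> a (2 * m - 1) j * a (2 * m) i"
    unfolding congr_def using assms by (intro cross_rel) auto
  then show "a (2 * m - 1) j * a (2 * m) i \<approx> a (2 * m) i * a (2 * m - 1) j"
    by (rule congr_sym)
qed

lemma A_pair_form:
  assumes "2 * n \<le> N" "i \<in> {1..N}" "j \<in> {1..N}"
  shows "pair_form n i j \<in> A"
  unfolding pair_form_def by (intro A_sum A_add A_mult A_gen A_z) (use assms in auto)

lemma A_pair_minor_sum:
  assumes "2 * n \<le> N" "C \<subseteq> {1..N}"
  shows "pair_minor_sum n p C \<in> A"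
  unfolding pair_minor_sum_def
proof (intro A_sum A_minor assms)
  fix T assume "T \<in> {T. T \<subseteq> {1..n} \<and> card T = p}"
  then have "row_pairs T \<subseteq> {1..N}" using row_pairs_subset_rows[of T n N] assms(1) by simp
  moreover from this have "finite (row_pairs T)" by (rule finite_subset) simp
  ultimately show "set (sorted_list_of_set (row_pairs T)) \<subseteq> {1..N}" by simp
qed

text \<open>The left side has the shape of the Pfaffian recursion with first index \<open>s\<close>,
  so this is the induction step for the closed form.\<close>

lemma pair_minor_sum_recursion:
  assumes N: "2 * n \<le> N" and sC: "insert s C \<subseteq> {1..N}"
    and s: "\<And>c. c \<in> C \<Longrightarrow> s < c" and card: "card C = 2 * p + 1"
  shows "(\<Sum>c\<in>C. z ^ rank C c * (pair_form n s c * pair_minor_sum n p (C - {c}))) \<approx>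
    pair_minor_sum n (Suc p) (insert s C)"
proof -
  let ?S = "\<lambda>p. {T. T \<subseteq> {1..n} \<and> card T = p}"
  let ?M = "\<lambda>T C. minor (sorted_list_of_set (row_pairs T)) C"
  let ?G = "\<lambda>T m. \<Sum>r\<in>{2 * m - 1, 2 * m}. z ^ rank (row_pairs T) r *
      (a r s * minor (sorted_list_of_set (row_pairs T - {r})) C)"
  note rows = row_pairs_subset_rows[OF _ N]
  have finC: "finite C" using finite_subset[OF sC] by simp
  have "(\<Sum>c\<in>C. z ^ rank C c * (pair_form n s c * pair_minor_sum n p (C - {c}))) \<approx>
    (\<Sum>c\<in>C. z ^ rank C c * ((\<Sum>m=1..n. a (2 * m - 1) s * a (2 * m) c +
        z * (a (2 * m) s * a (2 * m - 1) c)) * pair_minor_sum n p (C - {c})))"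
    by (intro congr_sum congr_left congr_right A_zpow A_pair_minor_sum pair_form_expand)
      (use N sC s in auto)
  also have "\<dots> = (\<Sum>c\<in>C. \<Sum>m=1..n. \<Sum>T\<in>?S p.
      a (2 * m - 1) s * (z ^ rank C c * (a (2 * m) c * ?M T (C - {c}))) +
      z * (a (2 * m) s * (z ^ rank C c * (a (2 * m - 1) c * ?M T (C - {c})))))"
    unfolding pair_minor_sum_def sum_product unfolding sum_distrib_left
    by (intro sum.cong refl)
      (simp add: distrib_left distrib_right mult.assoc gen_zpow zpow_left_commute[of z])
  \<comment> \<open>With the factor from column \<open>s\<close> in front, the sum over
    \<open>c\<close> is the top row expansion of a minor with one row of the pair \<open>m\<close>
    added above the rows of \<open>T\<close>.\<close>
  also have "\<dots> = (\<Sum>m=1..n. \<Sum>T\<in>?S p.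
      a (2 * m - 1) s * minor (2 * m # sorted_list_of_set (row_pairs T)) C +
      z * (a (2 * m) s * minor ((2 * m - 1) # sorted_list_of_set (row_pairs T)) C))"
    unfolding minor.simps sum_distrib_left sum.distrib
    by (simp only: sum.swap[of _ _ C])
  also have "\<dots> \<approx> (\<Sum>m=1..n. \<Sum>T\<in>?S p. if m \<in> T then 0 else ?G (insert m T) m)"
  proof (intro congr_sum)
    fix m T assume m: "m \<in> {1..n}" and "T \<in> ?S p"
    then have T: "T \<subseteq> {1..n}" by simp
    let ?R = "row_pairs T"
    have finR: "finite ?R" using finite_subset[OF rows[OF T]] by simp
    let ?w = "\<lambda>r. if r \<in> ?R then 0 else z ^ rank ?R r * minor (sorted_list_of_set (insert r ?R)) C"
    have mN: "2 * m \<in> {1..N}" "2 * m - 1 \<in> {1..N}" using m N by auto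
    have "a (2 * m - 1) s * minor (2 * m # sorted_list_of_set ?R) C +
        z * (a (2 * m) s * minor ((2 * m - 1) # sorted_list_of_set ?R) C) \<approx>
        a (2 * m - 1) s * ?w (2 * m) + z * (a (2 * m) s * ?w (2 * m - 1))"
      using sC mN by (intro congr_add congr_left A_gen A_z minor_insert_row rows[OF T]) auto
    also have "\<dots> = (if m \<in> T then 0 else ?G (insert m T) m)"
    proof (cases "m \<in> T")
      case True
      then have "2 * m \<in> ?R" "2 * m - 1 \<in> ?R" by (auto simp: row_pairs_def)
      with True show ?thesis by simp
    next
      case False
      have notin: "2 * m \<notin> ?R" "2 * m - 1 \<notin> ?R"
        using mem_row_pairs[OF T, of m] False m by simp_all
      have lt: "2 * m - 1 < 2 * m" using m by simp
      have R': "row_pairs (insert m T) = insert (2 * m - 1) (insert (2 * m) ?R)"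
        by (auto simp: row_pairs_def)
      \<comment> \<open>Only the row \<open>2 * m - 1\<close> could make a difference, and it is not
        in \<open>?R\<close>.\<close>
      have "rank ?R (2 * m) = rank ?R (2 * m - 1)"
      proof -
        have "y < 2 * m \<longleftrightarrow> y < 2 * m - 1" if "y \<in> ?R" for y
          using that notin by (cases "y = 2 * m - 1") auto
        then show ?thesis unfolding rank_def by (metis (mono_tags, lifting) Collect_cong)
      qed
      \<comment> \<open>In the enlarged row set the row \<open>2 * m\<close> has the new row
        \<open>2 * m - 1\<close> before it. This accounts for the factor \<open>z\<close> of the
        second term, so both terms get the exponents of a first column expansion.\<close>
      moreover have "rank (row_pairs (insert m T)) (2 * m - 1) = rank ?R (2 * m - 1)"
        "rank (row_pairs (insert m T)) (2 * m) = Suc (rank ?R (2 * m))"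
        unfolding R' using lt notin finR by (simp_all add: rank_insert)
      moreover have "row_pairs (insert m T) - {2 * m - 1} = insert (2 * m) ?R"
        "row_pairs (insert m T) - {2 * m} = insert (2 * m - 1) ?R"
        unfolding R' using lt notin by auto
      ultimately show ?thesis
        using False notin lt by (simp add: gen_zpow mult.assoc)
    qed
    finally show "a (2 * m - 1) s * minor (2 * m # sorted_list_of_set ?R) C +
        z * (a (2 * m) s * minor ((2 * m - 1) # sorted_list_of_set ?R) C) \<approx>
      (if m \<in> T then 0 else ?G (insert m T) m)" .
  qed
  also have "\<dots> = (\<Sum>T\<in>?S (Suc p). \<Sum>m\<in>T. ?G T m)"
    by (rule sum_add_element) simp
  also have "\<dots> = (\<Sum>T\<in>?S (Suc p). \<Sum>r\<in>row_pairs T. z ^ rank (row_pairs T) r *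
      (a r s * minor (sorted_list_of_set (row_pairs T - {r})) C))"
    by (intro sum.cong refl sum_row_pairs[symmetric]) auto
  \<comment> \<open>For each \<open>T\<close> the sum over its rows is the expansion along the
    smallest column \<open>s\<close>, read backwards.\<close>
  also have "\<dots> \<approx> pair_minor_sum n (Suc p) (insert s C)"
    unfolding pair_minor_sum_def
  proof (rule congr_sum, rule congr_sym, rule minor_expand_first_column)
    fix T assume "T \<in> ?S (Suc p)"
    then show "row_pairs T \<subseteq> {1..N}" "card (row_pairs T) = Suc (card C)"
      using rows card card_row_pairs[of T n] by auto
  qed (use sC s in auto)
  finally show ?thesis .
qed

end

section \<open>Passage to the quotient algebra\<close>

text \<open>A constant sits on the empty word, which is neutral for concatenation, so it commutes
  with every monomial; induction on the support extends this to sums of monomials.\<close>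

lemma nc_const_central: "f * nc_const c = nc_const c * f"
proof (induction f rule: update_induct)
  case const
  show ?case by simp
next
  case (update f w b)
  have "Poly_Mapping.update w b f = f + Poly_Mapping.single w b"
    using update.hyps(1)
    by (intro poly_mapping_eqI)
      (auto simp: lookup_update lookup_add lookup_single when_def in_keys_iff)
  with update.IH show ?case
    by (simp add: nc_const_def distrib_left distrib_right mult_single mult.commute)
qed

lemma nc_const_diff: "nc_const (c - d) = nc_const c - nc_const d"
  and nc_const_uminus: "nc_const (- c) = - nc_const c"
  and nc_const_mult: "nc_const (c * d) = nc_const c * nc_const d"
  and nc_const_one: "nc_const 1 = 1"
  by (simp_all add: nc_const_def single_diff single_uminus mult_single)

lemma nc_const_power: "nc_const (c ^ k) = nc_const c ^ k"
  by (induction k) (simp_all add: nc_const_one nc_const_mult)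

lemma qmatrix_relation_mem_ideal: "f \<in> qmatrix_relations q N \<Longrightarrow> f \<in> qmatrix_ideal q N"
  using ring.genideal_self[OF ring_free_algebra qmatrix_relations_carrier[unfolded qmatrix_free_def]]
  by (auto simp: qmatrix_ideal_def qmatrix_free_def)

text \<open>All assumptions but \<open>swap_rel\<close> are closure properties or defining
  relations. The exchange relation is the third defining relation plus \<open>q\<close> times the
  fourth.\<close>

lemma quantum_matrix_modulo_qmatrix_ideal:
  assumes "q \<noteq> 0"
  shows "quantum_matrix_modulo (nc_const (- q)) (\<lambda>i j. nc_var (i, j)) N
    (carrier (qmatrix_free N)) (qmatrix_ideal q N)"
proof -
  let ?F = "qmatrix_free N" and ?I = "qmatrix_ideal q N"
  interpret I: ideal ?I ?F
    by (rule ideal_qmatrix_ideal)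
  have F: "x \<oplus>\<^bsub>?F\<^esub> y = x + y" "x \<otimes>\<^bsub>?F\<^esub> y = x * y" "\<zero>\<^bsub>?F\<^esub> = 0" "\<one>\<^bsub>?F\<^esub> = 1" for x y
    by (simp_all add: qmatrix_free_def free_algebra_def)
  have const: "nc_const c \<in> carrier ?F" for c
    by (simp add: qmatrix_free_def nc_const_carrier)
  have left: "x * y \<in> ?I" if "x \<in> carrier ?F" "y \<in> ?I" for x y
    using I.I_l_closed[OF that(2,1)] by (simp add: F)
  have add: "x + y \<in> ?I" if "x \<in> ?I" "y \<in> ?I" for x y
    using additive_subgroup.a_closed[OF I.additive_subgroup_axioms that] by (simp add: F)
  have diff: "x - y \<in> ?I" if "x \<in> ?I" "y \<in> ?I" for x y
    using add[OF that(1) left[OF const[of "-1"] that(2)]] by (simp add: nc_const_uminus nc_const_one)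
  show ?thesis
  proof
    show "x * nc_const (- q) = nc_const (- q) * x" for x :: "(nat \<times> nat) nc_poly"
      by (rule nc_const_central)
    show "1 \<in> carrier ?F" "0 \<in> carrier ?F" "0 \<in> ?I"
      using const[of 1] const[of 0] additive_subgroup.zero_closed[OF I.additive_subgroup_axioms]
      by (simp_all add: F nc_const_def)
    show "x + y \<in> carrier ?F" "x * y \<in> carrier ?F" if "x \<in> carrier ?F" "y \<in> carrier ?F" for x y
      using I.add.m_closed[OF that] I.m_closed[OF that] by (simp_all add: F)
    show "nc_const (- q) \<in> carrier ?F" by (rule const)
    show "nc_var (i, j) \<in> carrier ?F" if "i \<in> {1..N}" "j \<in> {1..N}" for i j
      using that by (simp add: qmatrix_free_def nc_var_carrier)
    show "x - y \<in> ?I" if "x \<in> ?I" "y \<in> ?I" for x y using that by (rule diff)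
    show "x * y \<in> ?I" if "x \<in> carrier ?F" "y \<in> ?I" for x y using that by (rule left)
    show "x * y \<in> ?I" if "x \<in> ?I" "y \<in> carrier ?F" for x y
      using I.I_r_closed[OF that] by (simp add: F)
    show "nc_var (i, k) * nc_var (i, l) + nc_const (- q) * (nc_var (i, l) * nc_var (i, k)) \<in> ?I"
      if "i \<in> {1..N}" "k \<in> {1..N}" "l \<in> {1..N}" "k < l" for i k l
    proof -
      have "nc_var (i, k) * nc_var (i, l) - nc_const q * (nc_var (i, l) * nc_var (i, k))
          \<in> qmatrix_relations q N"
        unfolding qmatrix_relations_def Let_def using that by blast
      then show ?thesis
        using qmatrix_relation_mem_ideal by (simp add: nc_const_uminus)
    qed
    fix i j k l
    assume ijkl: "i \<in> {1..N}" "j \<in> {1..N}" "k \<in> {1..N}" "l \<in> {1..N}" "i < j" "k < l"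
    let ?ik = "nc_var (i, k)" and ?jl = "nc_var (j, l)" and ?il = "nc_var (i, l)"
      and ?jk = "nc_var (j, k)"
    have "?jk * ?il - ?il * ?jk \<in> qmatrix_relations q N"
      unfolding qmatrix_relations_def Let_def using ijkl by blast
    then show 3: "?jk * ?il - ?il * ?jk \<in> ?I"
      by (rule qmatrix_relation_mem_ideal)
    have "?ik * ?jl - ?jl * ?ik - nc_const (q - inverse q) * (?il * ?jk) \<in> qmatrix_relations q N"
      unfolding qmatrix_relations_def Let_def using ijkl by blast
    then have 4: "nc_const q * (?ik * ?jl - ?jl * ?ik - nc_const (q - inverse q) * (?il * ?jk)) \<in> ?I"
      by (intro left const qmatrix_relation_mem_ideal)
    \<comment> \<open>Multiplication by \<open>q\<close> clears the inverse; here \<open>q\<close>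
      has to be nonzero.\<close>
    have "nc_const q * nc_const (q - inverse q) =
        (nc_const q * nc_const q - 1 :: (nat \<times> nat) nc_poly)"
      using assms by (simp add: right_diff_distrib nc_const_diff nc_const_one flip: nc_const_mult)
    then have "nc_const q * (nc_const (q - inverse q) * x) = nc_const q * (nc_const q * x) - x"
      for x :: "(nat \<times> nat) nc_poly"
      by (simp only: left_diff_distrib mult_1 flip: mult.assoc)
    then have "?jk * ?il + nc_const (- q) * (?jl * ?ik)
        - nc_const (- q) * (?ik * ?jl + nc_const (- q) * (?il * ?jk)) =
      (?jk * ?il - ?il * ?jk) +
        nc_const q * (?ik * ?jl - ?jl * ?ik - nc_const (q - inverse q) * (?il * ?jk))"
      by (simp add: nc_const_uminus distrib_left right_diff_distrib)
    then show "?jk * ?il + nc_const (- q) * (?jl * ?ik)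
        - nc_const (- q) * (?ik * ?jl + nc_const (- q) * (?il * ?jk)) \<in> ?I"
      using add[OF 3 4] by (simp only:)
  qed
qed

definition qmatrix_coset ::
    "complex \<Rightarrow> nat \<Rightarrow> (nat \<times> nat) nc_poly \<Rightarrow> (nat \<times> nat) nc_poly set"
  where "qmatrix_coset q N f = qmatrix_ideal q N +>\<^bsub>qmatrix_free N\<^esub> f"

section \<open>The projection to the quotient algebra\<close>

context
  fixes q :: complex and N :: nat
begin

abbreviation (input) "F \<equiv> qmatrix_free N"
abbreviation (input) "J \<equiv> qmatrix_ideal q N"
abbreviation (input) "M \<equiv> qmatrix_algebra q N"
abbreviation (input) "coset \<equiv> qmatrix_coset q N"

interpretation I: ideal J F
  by (rule ideal_qmatrix_ideal)

interpretation M: ring M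
  by (rule ring_qmatrix_algebra)

lemma qmatrix_R_simps: "x \<oplus>\<^bsub>F\<^esub> y = x + y" "x \<otimes>\<^bsub>F\<^esub> y = x * y" "\<zero>\<^bsub>F\<^esub> = 0" "\<one>\<^bsub>F\<^esub> = 1"
    "c \<odot>\<^bsub>F\<^esub> x = nc_const c * x"
  by (simp_all add: qmatrix_free_def free_algebra_def)

lemma qmatrix_M_simps: "carrier M = carrier (F Quot J)" "x \<oplus>\<^bsub>M\<^esub> y = x \<oplus>\<^bsub>F Quot J\<^esub> y"
    "x \<otimes>\<^bsub>M\<^esub> y = x \<otimes>\<^bsub>F Quot J\<^esub> y" "\<zero>\<^bsub>M\<^esub> = \<zero>\<^bsub>F Quot J\<^esub>" "\<one>\<^bsub>M\<^esub> = \<one>\<^bsub>F Quot J\<^esub>"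
  by (simp_all only: qmatrix_algebra_def quot_algebra_def partial_object.simps
      monoid.simps ring.simps)

lemma qmatrix_const_closed: "nc_const c \<in> carrier F"
  by (simp add: qmatrix_free_def nc_const_carrier)

lemma qmatrix_add_closed: "\<lbrakk>f \<in> carrier F; g \<in> carrier F\<rbrakk> \<Longrightarrow> f + g \<in> carrier F"
  using I.add.m_closed[of f g] by (simp add: qmatrix_R_simps)

lemma qmatrix_mult_closed: "\<lbrakk>f \<in> carrier F; g \<in> carrier F\<rbrakk> \<Longrightarrow> f * g \<in> carrier F"
  using I.m_closed[of f g] by (simp add: qmatrix_R_simps)

lemma qmatrix_sum_closed: "(\<And>i. i \<in> S \<Longrightarrow> f i \<in> carrier F) \<Longrightarrow> sum f S \<in> carrier F"
  using I.zero_closed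
  by (induction S rule: infinite_finite_induct) (auto simp: qmatrix_R_simps qmatrix_add_closed)

lemma coset_closed: "f \<in> carrier F \<Longrightarrow> coset f \<in> carrier M"
  unfolding qmatrix_M_simps qmatrix_coset_def using ring_hom_closed[OF I.rcos_ring_hom] by blast

lemma coset_add:
  "\<lbrakk>f \<in> carrier F; g \<in> carrier F\<rbrakk> \<Longrightarrow> coset f \<oplus>\<^bsub>M\<^esub> coset g = coset (f + g)"
  using ring_hom_add[OF I.rcos_ring_hom, of f g] by (simp add: qmatrix_M_simps qmatrix_coset_def qmatrix_R_simps)

lemma coset_mult:
  "\<lbrakk>f \<in> carrier F; g \<in> carrier F\<rbrakk> \<Longrightarrow> coset f \<otimes>\<^bsub>M\<^esub> coset g = coset (f * g)"
  using ring_hom_mult[OF I.rcos_ring_hom, of f g] by (simp add: qmatrix_M_simps qmatrix_coset_def qmatrix_R_simps)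

lemma coset_one: "\<one>\<^bsub>M\<^esub> = coset 1"
  using ring_hom_one[OF I.rcos_ring_hom] by (simp add: qmatrix_M_simps qmatrix_coset_def qmatrix_R_simps)

lemma coset_zero: "\<zero>\<^bsub>M\<^esub> = coset 0"
  using ring_hom_zero[OF I.rcos_ring_hom I.ring_axioms I.quotient_is_ring]
  by (simp add: qmatrix_M_simps qmatrix_coset_def qmatrix_R_simps)

lemma coset_smult: "f \<in> carrier F \<Longrightarrow> c \<odot>\<^bsub>M\<^esub> coset f = coset (nc_const c * f)"
  using qmatrix_algebra_smult[of f N q c] by (simp add: qmatrix_coset_def qmatrix_R_simps)

lemma coset_minus:
  assumes "f \<in> carrier F" "g \<in> carrier F"
  shows "coset f \<ominus>\<^bsub>M\<^esub> coset g = coset (f - g)"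
proof -
  have g': "- g \<in> carrier F"
    using qmatrix_mult_closed[OF qmatrix_const_closed[of "-1"] assms(2)] by (simp add: nc_const_uminus nc_const_one)
  then have "\<ominus>\<^bsub>M\<^esub> coset g = coset (- g)"
    using assms by (intro M.minus_equality) (simp_all add: coset_add coset_zero coset_closed)
  then show ?thesis
    using assms g' by (simp add: M.minus_eq coset_add)
qed

lemma coset_sum:
  "(\<And>i. i \<in> S \<Longrightarrow> f i \<in> carrier F) \<Longrightarrow> (\<Oplus>\<^bsub>M\<^esub>i\<in>S. coset (f i)) = coset (sum f S)"
proof (induction S rule: infinite_finite_induct)
  case (insert x S)
  then show ?case
    by (simp add: coset_closed coset_add qmatrix_sum_closed Pi_def)
\<comment> \<open>Over an infinite index set both sums have the default value zero.\<close>
qed (simp_all add: coset_zero M.finsum_infinite)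

text \<open>Membership in the carrier is proved in the same induction because
  \<open>coset_mult\<close> needs it for the tail.\<close>

lemma coset_prod_list:
  "(\<And>x. x \<in> set xs \<Longrightarrow> f x \<in> carrier F) \<Longrightarrow>
    foldr (\<lambda>x y. x \<otimes>\<^bsub>M\<^esub> y) (map (\<lambda>x. coset (f x)) xs) \<one>\<^bsub>M\<^esub> = coset (foldr (*) (map f xs) 1) \<and>
    foldr (*) (map f xs) 1 \<in> carrier F"
  using I.one_closed
  by (induction xs) (auto simp: coset_one coset_mult qmatrix_mult_closed qmatrix_R_simps)

text \<open>Turns a congruence in the free algebra into an equation in the quotient:
  \<open>f\<close> is \<open>f - g\<close> plus \<open>g\<close> and so lies in the coset of
  \<open>g\<close>.\<close>

lemma coset_eqI: "\<lbrakk>f - g \<in> J; g \<in> carrier F\<rbrakk> \<Longrightarrow> coset f = coset g"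
proof -
  assume "f - g \<in> J" and g: "g \<in> carrier F"
  then have "f \<in> J +>\<^bsub>F\<^esub> g"
    by (auto simp: a_r_coset_def' qmatrix_R_simps intro!: bexI[of _ "f - g"])
  then show ?thesis
    unfolding qmatrix_coset_def using g I.a_repr_independence[OF _ g I.a_subgroup] by metis
qed

section \<open>Determinant and Pfaffian as cosets\<close>

interpretation central_minor "nc_const (- q)" "\<lambda>i j. nc_var (i :: nat, j :: nat)"
  by standard (rule nc_const_central)

lemma qmatrix_gen_coset: "qmatrix_gen q N i j = coset (nc_var (i, j))"
  by (simp add: qmatrix_gen_def qmatrix_coset_def)

lemma nc_var_closed: "\<lbrakk>i \<in> {1..N}; j \<in> {1..N}\<rbrakk> \<Longrightarrow> nc_var (i, j) \<in> carrier F"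
  by (simp add: qmatrix_free_def nc_var_carrier)

lemma coset_finsum_eq:
  assumes "\<And>i. i \<in> S \<Longrightarrow> x i = coset (f i)" "\<And>i. i \<in> S \<Longrightarrow> f i \<in> carrier F"
  shows "(\<Oplus>\<^bsub>M\<^esub>i\<in>S. x i) = coset (sum f S)"
proof -
  have "(\<Oplus>\<^bsub>M\<^esub>i\<in>S. x i) = (\<Oplus>\<^bsub>M\<^esub>i\<in>S. coset (f i))"
    using assms by (intro M.finsum_cong') (auto intro: coset_closed)
  then show ?thesis
    using assms(2) by (simp add: coset_sum)
qed

text \<open>Lift each summand to the free algebra, encode a permutation by its list of values, and
  apply \<open>minor_Leibniz\<close>.\<close>

lemma qdet_coset_minor:
  "qdet M q N (qmatrix_gen q N) = coset (minor [1..<Suc N] {1..N})"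
proof -
  let ?L = "[1..<Suc N]"
  let ?f = "\<lambda>\<sigma>. nc_const (- q) ^ list_inversions (map \<sigma> ?L) *
    foldr (*) (map2 (\<lambda>i j. nc_var (i, j)) ?L (map \<sigma> ?L)) 1"
  have map2: "map2 (\<lambda>i j. nc_var (i, j)) xs (map \<sigma> xs) = map (\<lambda>i. nc_var (i, \<sigma> i)) xs"
    for \<sigma> :: "nat \<Rightarrow> nat" and xs
    by (induction xs) auto
  have "qdet M q N (qmatrix_gen q N) = coset (\<Sum>\<sigma> | \<sigma> permutes {1..N}. ?f \<sigma>)"
    unfolding qdet_def
  proof (rule coset_finsum_eq)
    fix \<sigma> assume "\<sigma> \<in> {\<sigma>. \<sigma> permutes {1..N}}"
    then have \<sigma>: "\<sigma> permutes {1..N}" by simp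
    have "nc_var (i, \<sigma> i) \<in> carrier F" if "i \<in> set ?L" for i
      using that permutes_in_image[OF \<sigma>, of i] by (intro nc_var_closed) auto
    note * = coset_prod_list[of ?L "\<lambda>i. nc_var (i, \<sigma> i)", OF this]
    show "(- q) ^ perm_inversions N \<sigma> \<odot>\<^bsub>M\<^esub>
        foldr (\<lambda>x y. x \<otimes>\<^bsub>M\<^esub> y) (map (\<lambda>i. qmatrix_gen q N i (\<sigma> i)) ?L) \<one>\<^bsub>M\<^esub> = coset (?f \<sigma>)"
      unfolding perm_inversions_list_inversions[OF \<sigma>] qmatrix_gen_coset map2
      using * by (simp add: coset_smult nc_const_power del: upt_Suc)
    show "?f \<sigma> \<in> carrier F"
      unfolding map2 nc_const_power[symmetric] using * by (intro qmatrix_mult_closed qmatrix_const_closed) simp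
  qed
  also have "(\<Sum>\<sigma> | \<sigma> permutes {1..N}. ?f \<sigma>) = minor ?L {1..N}"
    using sum.reindex_bij_betw[OF bij_betw_permutes_permutations_of_set[of N],
        of "\<lambda>xs. nc_const (- q) ^ list_inversions xs *
          foldr (*) (map2 (\<lambda>i j. nc_var (i, j)) ?L xs) 1"]
    by (simp add: minor_Leibniz del: upt_Suc)
  finally show ?thesis .
qed

lemma qmatrix_pair_form_coset:
  assumes "2 * n \<le> N" "i \<in> {1..N}" "j \<in> {1..N}"
  shows "(\<Oplus>\<^bsub>M\<^esub>m \<in> {1..n}.
      qmatrix_gen q N (2 * m - 1) i \<otimes>\<^bsub>M\<^esub> qmatrix_gen q N (2 * m) j \<ominus>\<^bsub>M\<^esub>
        q \<odot>\<^bsub>M\<^esub> (qmatrix_gen q N (2 * m - 1) j \<otimes>\<^bsub>M\<^esub> qmatrix_gen q N (2 * m) i)) =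
    coset (pair_form n i j)"
  unfolding pair_form_def
proof (rule coset_finsum_eq)
  fix m assume m: "m \<in> {1..n}"
  have *: "nc_var (2 * m - 1, i) \<in> carrier F" "nc_var (2 * m - 1, j) \<in> carrier F"
      "nc_var (2 * m, i) \<in> carrier F" "nc_var (2 * m, j) \<in> carrier F"
    using m assms by (auto intro!: nc_var_closed)
  then show "qmatrix_gen q N (2 * m - 1) i \<otimes>\<^bsub>M\<^esub> qmatrix_gen q N (2 * m) j \<ominus>\<^bsub>M\<^esub>
      q \<odot>\<^bsub>M\<^esub> (qmatrix_gen q N (2 * m - 1) j \<otimes>\<^bsub>M\<^esub> qmatrix_gen q N (2 * m) i) =
    coset (nc_var (2 * m - 1, i) * nc_var (2 * m, j) +
      nc_const (- q) * (nc_var (2 * m - 1, j) * nc_var (2 * m, i)))"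
    unfolding qmatrix_gen_coset
    by (simp add: coset_mult coset_smult coset_minus qmatrix_mult_closed qmatrix_const_closed
        nc_const_uminus del: One_nat_def)
  show "nc_var (2 * m - 1, i) * nc_var (2 * m, j) +
      nc_const (- q) * (nc_var (2 * m - 1, j) * nc_var (2 * m, i)) \<in> carrier F"
    using * by (intro qmatrix_add_closed qmatrix_mult_closed qmatrix_const_closed)
qed

text \<open>In the quotient both sides obey the same recursion. The induction starts at length two,
  where \<open>qpf_list\<close> has its base value.\<close>

lemma qpf_list_coset_pair_minor_sum:
  assumes q: "q \<noteq> 0" and n: "2 * n \<le> N"
    and b: "\<And>i j. \<lbrakk>i \<in> {1..N}; j \<in> {1..N}\<rbrakk> \<Longrightarrow> b i j = coset (pair_form n i j)"
    and "sorted_wrt (<) s" "set s \<subseteq> {1..N}" "length s = 2 * Suc p"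
  shows "qpf_list M q b s = coset (pair_minor_sum n (Suc p) (set s))"
  using assms(4-)
proof (induction p arbitrary: s)
  interpret Q: quantum_matrix_modulo "nc_const (- q)" "\<lambda>i j. nc_var (i, j)" N "carrier F" J
    by (rule quantum_matrix_modulo_qmatrix_ideal[OF q])
  have rec: "coset (\<Sum>c\<in>set t. nc_const (- q) ^ rank (set t) c *
        (pair_form n x c * pair_minor_sum n p (set t - {c}))) =
      coset (pair_minor_sum n (Suc p) (set (x # t)))"
    if "sorted_wrt (<) (x # t)" "set (x # t) \<subseteq> {1..N}" "length t = 2 * p + 1" for x t p
  proof (rule coset_eqI)
    have "card (set t) = 2 * p + 1"
      using that strict_sorted_iff[of t] by (simp add: distinct_card)
    then show "(\<Sum>c\<in>set t. nc_const (- q) ^ rank (set t) c *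
        (pair_form n x c * pair_minor_sum n p (set t - {c}))) -
        pair_minor_sum n (Suc p) (set (x # t)) \<in> J"
      using Q.pair_minor_sum_recursion[OF n, of x "set t" p] that
      by (simp add: Q.congr_def)
    show "pair_minor_sum n (Suc p) (set (x # t)) \<in> carrier F"
      using that by (intro Q.A_pair_minor_sum n)
  qed
  {
    case 0
    then obtain i j where s: "s = [i, j]"
      by (auto simp: length_Suc_conv numeral_2_eq_2)
    \<comment> \<open>For two columns the recursion has the single term with exponent 0 and empty
      remaining minor, so \<open>rec\<close> covers the base case too.\<close>
    then have "coset (pair_form n i j) = coset (pair_minor_sum n (Suc 0) (set s))"
      using rec[of i "[j]" 0] 0 rank_eq_0[of "{j}" j] by (simp add: pair_minor_sum_0)
    with s 0 b show ?case by simp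
  next
    case (Suc p)
    then obtain x t where s: "s = x # t" and t: "length t = 2 * Suc p + 1"
      by (cases s) auto
    have sorted: "sorted_wrt (<) t" and xt: "set t \<subseteq> {1..N}" "x \<in> {1..N}"
      using Suc.prems s by auto
    let ?f = "\<lambda>c. nc_const (- q) ^ rank (set t) c *
        (pair_form n x c * pair_minor_sum n (Suc p) (set t - {c}))"
    have "qpf_list M q b s = (\<Oplus>\<^bsub>M\<^esub> j \<in> {..<length t}. (- q) ^ j \<odot>\<^bsub>M\<^esub>
        (b x (t ! j) \<otimes>\<^bsub>M\<^esub> qpf_list M q b (take j t @ drop (Suc j) t)))"
      unfolding s using t by (intro qpf_list_Cons) simp
    also have "\<dots> = coset (\<Sum>j<length t. ?f (t ! j))"
    proof (rule coset_finsum_eq)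
      fix j assume "j \<in> {..<length t}"
      then have j: "j < length t" by simp
      note t' = sorted_wrt_less_remove_nth[OF sorted j]
      have tj: "t ! j \<in> {1..N}" using j xt(1) nth_mem by blast
      have "qpf_list M q b (take j t @ drop (Suc j) t) =
          coset (pair_minor_sum n (Suc p) (set t - {t ! j}))"
        unfolding t'(2)[symmetric]
        by (rule Suc.IH[OF t'(1)]) (use t' t j xt in auto)
      moreover have "pair_form n x (t ! j) \<in> carrier F"
        "pair_minor_sum n (Suc p) (set t - {t ! j}) \<in> carrier F"
        using n xt tj by (auto intro!: Q.A_pair_form Q.A_pair_minor_sum)
      ultimately show "(- q) ^ j \<odot>\<^bsub>M\<^esub> (b x (t ! j) \<otimes>\<^bsub>M\<^esub>
            qpf_list M q b (take j t @ drop (Suc j) t)) = coset (?f (t ! j))"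
          "?f (t ! j) \<in> carrier F"
        using xt(2) tj
        by (simp_all add: b coset_mult coset_smult qmatrix_mult_closed qmatrix_const_closed
            rank_nth[OF sorted j] flip: nc_const_power)
    qed
    \<comment> \<open>The entries of \<open>t\<close> are distinct, so positions and columns
      correspond bijectively.\<close>
    also have "(\<Sum>j<length t. ?f (t ! j)) = sum ?f (set t)"
      by (rule sum.reindex_bij_betw, rule bij_betw_nth) (use sorted strict_sorted_iff in auto)
    also have "coset \<dots> = coset (pair_minor_sum n (Suc (Suc p)) (set s))"
      unfolding s by (rule rec) (use Suc.prems s t in auto)
    finally show ?case .
  }
qed

lemma qpf_eq_qdet:
  assumes "q \<noteq> 0" "n \<ge> 1" "N = 2 * n"
    and "\<And>i j. \<lbrakk>i \<in> {1..N}; j \<in> {1..N}\<rbrakk> \<Longrightarrow> b i j = coset (pair_form n i j)"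
  shows "qpf M q n b = qdet M q N (qmatrix_gen q N)"
proof -
  have set: "set [1..<Suc (2 * n)] = {1..N}"
    by (simp only: set_upt atLeastLessThanSuc_atLeastAtMost assms(3))
  \<comment> \<open>As \<open>n\<close> is at least 1, \<open>Suc (n - 1)\<close> is
    \<open>n\<close>. All row pairs are then used, which leaves one minor, the determinant.\<close>
  have "qpf M q n b = coset (pair_minor_sum n (Suc (n - 1)) (set [1..<Suc (2 * n)]))"
    unfolding qpf_def
    by (rule qpf_list_coset_pair_minor_sum) (use assms set in \<open>simp_all del: upt_Suc\<close>)
  also have "\<dots> = qdet M q N (qmatrix_gen q N)"
    unfolding set qdet_coset_minor using assms by (simp add: pair_minor_sum_full del: upt_Suc)
  finally show ?thesis .
qed

end

theorem theorem2p12: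
  fixes q :: complex and n :: nat
    and M :: "(complex, (nat \<times> nat) nc_poly set) module" (structure)
    and a b :: "nat \<Rightarrow> nat \<Rightarrow> (nat \<times> nat) nc_poly set"
  assumes "q \<noteq> 0" and "n \<ge> 1"
  defines "M \<equiv> qmatrix_algebra q (2 * n)"
    and "a \<equiv> qmatrix_gen q (2 * n)"
    and "b \<equiv> (\<lambda>i j. \<Oplus>m \<in> {1..n}.
           a (2 * m - 1) i \<otimes> a (2 * m) j \<ominus> q \<odot> (a (2 * m - 1) j \<otimes> a (2 * m) i))"
  shows "qpf M q n b = qdet M q (2 * n) a"
  unfolding M_def a_def b_def
  by (rule qpf_eq_qdet[OF assms(1,2) refl]) (simp only: qmatrix_pair_form_coset order_refl)

end
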